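(* Let $\pi$ be a commutative semigroup and let $(\{A_\varphi\}_{\varphi\in\pi},\{\prec_{p,q}\}_{p,q\in\pi},\{\succ_{p,q}\}_{p,q\in\pi})$ be a commutative dendriform T-algebra, in the sense that $a\succ_{p,q}b=b\prec_{q,p}a$ for all $a\in A_p$, $b\in A_q$, $p,q\in\pi$. Define $$a\star_{p,q}b:=a\succ_{p,q}b=b\prec_{q,p}a$$ for $a\in A_p$, $b\in A_q$ and $p,q\in\pi$. Then $(\{A_\varphi\}_{\varphi\in\pi},\{\star_{p,q}\}_{p,q\in\pi})$ is a Zinbiel T-algebra.
   Context: $K$ is a field; all vector spaces, tensor products and linear maps are over $K$. A dendriform T-algebra (for a semigroup $\pi$) is a family of vector spaces $\{A_\varphi\}_{\varphi\in\pi}$ with bilinear operations (linear maps) $\prec_{p,q},\succ_{p,q}:A_p\otimes A_q\to A_{pq}$ such that for all $p,q,t\in\pi$, $a\in A_p,b\in A_q,c\in A_t$: $(a\prec_{p,q}b)\prec_{pq,t}c=a\prec_{p,qt}(b\prec_{q,t}c+b\succ_{q,t}c)$; $(a\succ_{p,q}b)\prec_{pq,t}c=a\succ_{p,qt}(b\prec_{q,t}c)$; $(a\prec_{p,q}b+a\succ_{p,q}b)\succ_{pq,t}c=a\succ_{p,qt}(b\succ_{q,t}c)$. For a commutative semigroup $\pi$, a Zinbiel T-algebra is a family of vector spaces $\{A_\varphi\}_{\varphi\in\pi}$ with bilinear operations $\star_{p,q}:A_p\otimes A_q\to A_{pq}$ such that $a\star_{p,qt}(b\star_{q,t}c)=(a\star_{p,q}b)\star_{pq,t}c+(b\star_{q,p}a)\star_{qp,t}c$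 for all $p,q,t\in\pi$, $a\in A_p,b\in A_q,c\in A_t$. *)

theory Defs
  imports "HOL-Algebra.Module"
begin

text \<open>
  The semigroup indexing a family is a type of class \<open>semigroup_mult\<close>
  (\<open>ab_semigroup_mult\<close> if commutative).  A vector space over a field \<open>K\<close> is a
  \<open>module\<close> over \<open>K\<close>.  The spaces \<open>A p\<close> share an element type, but each has its own carrier
  and its own addition, zero and scalar multiplication.  Operations are only constrained on
  carriers.
\<close>

definition linear_map ::
  "('k, 'm) ring_scheme \<Rightarrow> ('k, 'a, 'n) module_scheme \<Rightarrow> ('k, 'b, 'l) module_scheme \<Rightarrow>
    ('a \<Rightarrow> 'b) \<Rightarrow> bool"
  where "linear_map K V W f \<longleftrightarrow>
    f \<in> carrier V \<rightarrow> carrier W \<and>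
    (\<forall>x\<in>carrier V. \<forall>y\<in>carrier V. f (x \<oplus>\<^bsub>V\<^esub> y) = f x \<oplus>\<^bsub>W\<^esub> f y) \<and>
    (\<forall>k\<in>carrier K. \<forall>x\<in>carrier V. f (k \<odot>\<^bsub>V\<^esub> x) = k \<odot>\<^bsub>W\<^esub> f x)"

text \<open>A linear map on a tensor product \<open>U \<otimes> V\<close> is given as a bilinear map on \<open>U\<close> and \<open>V\<close>.\<close>

definition bilinear_map ::
  "('k, 'm) ring_scheme \<Rightarrow> ('k, 'a, 'n) module_scheme \<Rightarrow> ('k, 'b, 'l) module_scheme \<Rightarrow>
    ('k, 'c, 'r) module_scheme \<Rightarrow> ('a \<Rightarrow> 'b \<Rightarrow> 'c) \<Rightarrow> bool"
  where "bilinear_map K U V W f \<longleftrightarrow>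
    (\<forall>x\<in>carrier U. linear_map K V W (\<lambda>y. f x y)) \<and>
    (\<forall>y\<in>carrier V. linear_map K U W (\<lambda>x. f x y))"

locale vector_space_family = field K for K :: "('k, 'm) ring_scheme" +
  fixes A :: "'p \<Rightarrow> ('k, 'a) module"
  assumes vector_space: "module K (A p)"

locale dendriform_T_algebra = vector_space_family K A
  for K :: "('k, 'm) ring_scheme"
    and A :: "'p::semigroup_mult \<Rightarrow> ('k, 'a) module" +
  fixes prec succ :: "'p \<Rightarrow> 'p \<Rightarrow> 'a \<Rightarrow> 'a \<Rightarrow> 'a"
  assumes prec_bilinear: "bilinear_map K (A p) (A q) (A (p * q)) (prec p q)"
    and succ_bilinear: "bilinear_map K (A p) (A q) (A (p * q)) (succ p q)"
    and prec_prec: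
      "\<lbrakk>a \<in> carrier (A p); b \<in> carrier (A q); c \<in> carrier (A t)\<rbrakk> \<Longrightarrow>
        prec (p * q) t (prec p q a b) c =
        prec p (q * t) a (prec q t b c \<oplus>\<^bsub>A (q * t)\<^esub> succ q t b c)"
    and succ_prec:
      "\<lbrakk>a \<in> carrier (A p); b \<in> carrier (A q); c \<in> carrier (A t)\<rbrakk> \<Longrightarrow>
        prec (p * q) t (succ p q a b) c = succ p (q * t) a (prec q t b c)"
    and succ_succ:
      "\<lbrakk>a \<in> carrier (A p); b \<in> carrier (A q); c \<in> carrier (A t)\<rbrakk> \<Longrightarrow>
        succ (p * q) t (prec p q a b \<oplus>\<^bsub>A (p * q)\<^esub> succ p q a b) c =
        succ p (q * t) a (succ q t b c)"

locale commutative_dendriform_T_algebra = dendriform_T_algebra K A prec succ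
  for K :: "('k, 'm) ring_scheme"
    and A :: "'p::ab_semigroup_mult \<Rightarrow> ('k, 'a) module"
    and prec succ :: "'p \<Rightarrow> 'p \<Rightarrow> 'a \<Rightarrow> 'a \<Rightarrow> 'a" +
  assumes commutative:
    "\<lbrakk>a \<in> carrier (A p); b \<in> carrier (A q)\<rbrakk> \<Longrightarrow> succ p q a b = prec q p b a"

locale zinbiel_T_algebra = vector_space_family K A
  for K :: "('k, 'm) ring_scheme"
    and A :: "'p::ab_semigroup_mult \<Rightarrow> ('k, 'a) module" +
  fixes star :: "'p \<Rightarrow> 'p \<Rightarrow> 'a \<Rightarrow> 'a \<Rightarrow> 'a"
  assumes star_bilinear: "bilinear_map K (A p) (A q) (A (p * q)) (star p q)"
    and zinbiel:
      "\<lbrakk>a \<in> carrier (A p); b \<in> carrier (A q); c \<in> carrier (A t)\<rbrakk> \<Longrightarrow>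
        star p (q * t) a (star q t b c) =
        star (p * q) t (star p q a b) c \<oplus>\<^bsub>A (p * q * t)\<^esub>
        star (q * p) t (star q p b a) c"

end

theory Submission
  imports Defs
begin

text \<open>The Zinbiel identity for \<open>succ\<close> is the third dendriform axiom read from
  right to left: it gives \<open>succ p (q * t) a (succ q t b c)\<close> as the product of the sum
  of \<open>prec p q a b\<close> and \<open>succ p q a b\<close> with \<open>c\<close>. Additivity
  in the left argument splits this product into two terms, and commutativity turns
  \<open>prec p q a b\<close> into \<open>succ q p b a\<close> (\<open>succ_zinbiel\<close>). Since
  \<open>star\<close> agrees with \<open>succ\<close> on the carriers, it inherits both this
  identity and bilinearity.\<close>

lemma linear_map_cong:
  assumes "module K V" and "linear_map K V W f"
    and "\<And>x. x \<in> carrier V \<Longrightarrow> g x = f x"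
  shows "linear_map K V W g"
proof -
  \<comment> \<open>The module axioms close the carrier under sums and scalar multiples, so the
    agreement of \<open>g\<close> with \<open>f\<close> also applies at those points.\<close>
  interpret V: module K V by fact
  show ?thesis
    using assms(2) unfolding linear_map_def by (auto simp: assms(3))
qed

text \<open>Needed because \<open>star\<close> is prescribed only on carriers, so it may differ from
  \<open>succ\<close> as a function; bilinearity depends only on the values on carriers.\<close>

lemma bilinear_map_cong:
  assumes "module K U" and "module K V" and "bilinear_map K U V W f"
    and "\<And>x y. \<lbrakk>x \<in> carrier U; y \<in> carrier V\<rbrakk> \<Longrightarrow> g x y = f x y"
  shows "bilinear_map K U V W g"
  unfolding bilinear_map_def
proof (intro conjI ballI)
  fix x assume x: "x \<in> carrier U"
  then have "linear_map K V W (f x)"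
    using assms(3) unfolding bilinear_map_def by blast
  with assms(2) show "linear_map K V W (\<lambda>y. g x y)"
    by (rule linear_map_cong) (rule assms(4)[OF x])
next
  fix y assume y: "y \<in> carrier V"
  then have "linear_map K U W (\<lambda>x. f x y)"
    using assms(3) unfolding bilinear_map_def by blast
  with assms(1) show "linear_map K U W (\<lambda>x. g x y)"
    by (rule linear_map_cong) (rule assms(4)[OF _ y])
qed

lemma bilinear_map_closed:
  "\<lbrakk>bilinear_map K U V W f; x \<in> carrier U; y \<in> carrier V\<rbrakk> \<Longrightarrow> f x y \<in> carrier W"
  by (auto simp: bilinear_map_def linear_map_def)

lemma bilinear_map_add_left:
  "\<lbrakk>bilinear_map K U V W f; x \<in> carrier U; x' \<in> carrier U; y \<in> carrier V\<rbrakk> \<Longrightarrow>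
    f (x \<oplus>\<^bsub>U\<^esub> x') y = f x y \<oplus>\<^bsub>W\<^esub> f x' y"
  by (auto simp: bilinear_map_def linear_map_def)

lemma (in commutative_dendriform_T_algebra) succ_zinbiel:
  assumes a: "a \<in> carrier (A p)" and b: "b \<in> carrier (A q)" and c: "c \<in> carrier (A t)"
  shows "succ p (q * t) a (succ q t b c) =
    succ (p * q) t (succ p q a b) c \<oplus>\<^bsub>A (p * q * t)\<^esub> succ (q * p) t (succ q p b a) c"
proof -
  interpret module K "A (p * q * t)" by (rule vector_space)
  have ab: "succ p q a b \<in> carrier (A (p * q))"
    using succ_bilinear a b by (rule bilinear_map_closed)
  have ba: "prec p q a b \<in> carrier (A (p * q))"
    using prec_bilinear a b by (rule bilinear_map_closed)
  have "succ p (q * t) a (succ q t b c) =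
      succ (p * q) t (prec p q a b \<oplus>\<^bsub>A (p * q)\<^esub> succ p q a b) c"
    using succ_succ[OF a b c] by simp
  also have "\<dots> = succ (p * q) t (prec p q a b) c \<oplus>\<^bsub>A (p * q * t)\<^esub> succ (p * q) t (succ p q a b) c"
    using succ_bilinear ba ab c by (rule bilinear_map_add_left)
  \<comment> \<open>The dendriform axiom puts the \<open>prec\<close> term first, the Zinbiel
    identity puts it last.\<close>
  also have "\<dots> = succ (p * q) t (succ p q a b) c \<oplus>\<^bsub>A (p * q * t)\<^esub> succ (p * q) t (prec p q a b) c"
    by (intro M.a_comm bilinear_map_closed[OF succ_bilinear] ab ba c)
  \<comment> \<open>Commutativity of the semigroup is used here as well: it identifies the degrees
    \<open>p * q\<close> and \<open>q * p\<close>.\<close>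
  also have "succ (p * q) t (prec p q a b) c = succ (q * p) t (succ q p b a) c"
    by (simp add: commutative[OF b a] mult.commute)
  finally show ?thesis .
qed

theorem proposition4p15:
  fixes K :: "('k, 'm) ring_scheme"
    and A :: "'p::ab_semigroup_mult \<Rightarrow> ('k, 'a) module"
    and prec succ star :: "'p \<Rightarrow> 'p \<Rightarrow> 'a \<Rightarrow> 'a \<Rightarrow> 'a"
  assumes "commutative_dendriform_T_algebra K A prec succ"
    and "\<And>p q a b. \<lbrakk>a \<in> carrier (A p); b \<in> carrier (A q)\<rbrakk> \<Longrightarrow> star p q a b = succ p q a b"
  shows "zinbiel_T_algebra K A star"
proof -
  interpret commutative_dendriform_T_algebra K A prec succ by fact
  show ?thesis
  proof
    fix p q
    show "bilinear_map K (A p) (A q) (A (p * q)) (star p q)"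
      using vector_space vector_space succ_bilinear assms(2) by (rule bilinear_map_cong)
  next
    fix a b c p q t
    assume abc: "a \<in> carrier (A p)" "b \<in> carrier (A q)" "c \<in> carrier (A t)"
    then show "star p (q * t) a (star q t b c) =
        star (p * q) t (star p q a b) c \<oplus>\<^bsub>A (p * q * t)\<^esub> star (q * p) t (star q p b a) c"
      \<comment> \<open>Closure puts the inner products in the carriers, so that the outer
        \<open>star\<close> can be replaced by \<open>succ\<close> too.\<close>
      by (simp add: assms(2) bilinear_map_closed[OF succ_bilinear] succ_zinbiel)
  qed
qed

end
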